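(* Let $L$ be a BCF lattice. Then $\operatorname{Dim}L$, endowed with its algebraic preordering, is an antisymmetric refinement monoid satisfying the interval axiom and the pseudo-cancellation property; furthermore, it admits an embedding (for the monoid structure as well as for the ordering) into a power of $\overline{\mathbb{Z}}^+=\mathbb{Z}^+\cup\{\infty\}$.
   Context: A partially ordered set (in particular a lattice) is BCF if it has no infinite bounded chain. Lattices are not assumed to be bounded. For a lattice $L$, the dimension monoid $\operatorname{Dim}L$ is the commutative monoid defined by generators $\Delta(a,b)$ (for $a\leq b$ in $L$) and the relations: (D0) $\Delta(a,a)=0$ for all $a\in L$; (D1) $\Delta(a,c)=\Delta(a,b)+\Delta(b,c)$ for all $a\leq b\leq c$ in $L$; (D2) $\Delta(a,a\vee b)=\Delta(a\wedge b,b)$ for all $a,b\in L$. Let $M$ be a commutative monoid. Its algebraic preordering is: $x\leq y$ iff there is $z\in M$ with $x+z=y$; $M$ is antisymmetric if this preordering is antisymmetric. Write $x\ll y$ if $x+y=y$. $M$ is a refinement monoid if whenever $a_0+a_1=b_0+b_1$ in $M$, there are $c_{ij}\in M$ ($i,j<2$) such that $a_i=c_{i0}+c_{i1}$ and $b_i=c_{0i}+c_{1i}$ for all $i<2$. Interval axiom: for all $x,y_0,y_1,z\in M$, if $z\leq x+y_0$ and $z\leq x+y_1$, then there is $y\in M$ with $y\leq y_0$, $y\leq y_1$ and $z\leq x+y$. Pseudo-cancellation property: for all $x,y,z\in M$, if $x+z\leq y+z$, then there is $t\in M$ with $t\ll z$ and $x\leq y+t$. $\overline{\mathbb{Z}}^+=\mathbb{Z}^+\cup\{\infty\}$,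 where $\mathbb{Z}^+=\{0,1,2,\ldots\}$, carries its natural addition (with $x+\infty=\infty$) and order; powers of it are taken with componentwise addition and order. *)

theory Defs
  imports "HOL-Library.Multiset" "HOL-Library.Extended_Nat" "HOL-Library.Function_Algebras"
begin

text \<open>"Bounded" means bounded on both sides.\<close>

definition bcf :: "'a::order itself \<Rightarrow> bool" where
  "bcf _ \<longleftrightarrow>
     (\<forall>C :: 'a set. Complete_Partial_Order.chain (\<le>) C \<and> bdd_below C \<and> bdd_above C \<longrightarrow> finite C)"

definition alg_le :: "'m::comm_monoid_add \<Rightarrow> 'm \<Rightarrow> bool" (infix "\<preceq>" 50) where
  "x \<preceq> y \<longleftrightarrow> (\<exists>z. x + z = y)"

definition absorbed :: "'m::comm_monoid_add \<Rightarrow> 'm \<Rightarrow> bool" (infix "\<lless>" 50) where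
  "x \<lless> y \<longleftrightarrow> x + y = y"

definition antisymmetric_monoid :: "'m::comm_monoid_add itself \<Rightarrow> bool" where
  "antisymmetric_monoid _ \<longleftrightarrow> (\<forall>x y :: 'm. x \<preceq> y \<and> y \<preceq> x \<longrightarrow> x = y)"

definition refinement_monoid :: "'m::comm_monoid_add itself \<Rightarrow> bool" where
  "refinement_monoid _ \<longleftrightarrow>
     (\<forall>a0 a1 b0 b1 :: 'm. a0 + a1 = b0 + b1 \<longrightarrow>
        (\<exists>c00 c01 c10 c11. a0 = c00 + c01 \<and> a1 = c10 + c11 \<and> b0 = c00 + c10 \<and> b1 = c01 + c11))"

definition interval_axiom :: "'m::comm_monoid_add itself \<Rightarrow> bool" where
  "interval_axiom _ \<longleftrightarrow>
     (\<forall>x y0 y1 z :: 'm. z \<preceq> x + y0 \<and> z \<preceq> x + y1 \<longrightarrow>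
        (\<exists>y. y \<preceq> y0 \<and> y \<preceq> y1 \<and> z \<preceq> x + y))"

definition pseudo_cancellation :: "'m::comm_monoid_add itself \<Rightarrow> bool" where
  "pseudo_cancellation _ \<longleftrightarrow>
     (\<forall>x y z :: 'm. x + z \<preceq> y + z \<longrightarrow> (\<exists>t. t \<lless> z \<and> x \<preceq> y + t))"

text \<open>
  The power \<^typ>\<open>'i \<Rightarrow> enat\<close> carries the componentwise addition and order
  (from \<^theory>\<open>HOL-Library.Function_Algebras\<close> and the order on function types).
\<close>

definition enat_power_embedding :: "('m::comm_monoid_add \<Rightarrow> 'i \<Rightarrow> enat) \<Rightarrow> bool" where
  "enat_power_embedding f \<longleftrightarrow>
     inj f \<and> f 0 = 0 \<and> (\<forall>x y. f (x + y) = f x + f y) \<and> (\<forall>x y. x \<preceq> y \<longleftrightarrow> f x \<le> f y)"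

text \<open>
  The index type \<^typ>\<open>'m \<Rightarrow> enat\<close> below loses no generality: the coordinates of any map from
  \<^typ>\<open>'m\<close> to a power of \<^typ>\<open>enat\<close>, over whatever index set, are functions \<^typ>\<open>'m \<Rightarrow> enat\<close>,
  so one may drop repeated coordinates, index the remaining ones by themselves and put the zero
  function in all unused coordinates.
\<close>

definition embeds_in_enat_power :: "'m::comm_monoid_add itself \<Rightarrow> bool" where
  "embeds_in_enat_power _ \<longleftrightarrow>
     (\<exists>f :: 'm \<Rightarrow> ('m \<Rightarrow> enat) \<Rightarrow> enat. enat_power_embedding f)"

text \<open>
  \<open>Dim L\<close> is the free commutative monoid (finite multisets) on the pairs \<open>a \<le> b\<close>, modulo the
  congruence generated by (D0), (D1), (D2).
\<close>

typedef (overloaded) 'a ivl = "{(a, b). a \<le> (b :: 'a::order)}"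
  by auto

definition ivl :: "'a::order \<Rightarrow> 'a \<Rightarrow> 'a ivl" where
  \<comment> \<open>only meaningful for \<open>a \<le> b\<close>\<close>
  "ivl a b = Abs_ivl (a, b)"

inductive dim_cong :: "'a::lattice ivl multiset \<Rightarrow> 'a ivl multiset \<Rightarrow> bool" where
  D0: "dim_cong {#ivl a a#} {#}"
| D1: "a \<le> b \<Longrightarrow> b \<le> c \<Longrightarrow> dim_cong {#ivl a c#} ({#ivl a b#} + {#ivl b c#})"
| D2: "dim_cong {#ivl a (sup a b)#} {#ivl (inf a b) b#}"
| refl: "dim_cong X X"
| sym: "dim_cong X Y \<Longrightarrow> dim_cong Y X"
| trans: "dim_cong X Y \<Longrightarrow> dim_cong Y Z \<Longrightarrow> dim_cong X Z"
| add: "dim_cong X Y \<Longrightarrow> dim_cong (X + Z) (Y + Z)"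

quotient_type (overloaded) 'a Dim = "'a::lattice ivl multiset" / dim_cong
  by (intro equivpI reflpI sympI transpI) (blast intro: dim_cong.refl dim_cong.sym dim_cong.trans)+

instantiation Dim :: (lattice) comm_monoid_add
begin

lift_definition zero_Dim :: "'a Dim" is "{#}" .

lift_definition plus_Dim :: "'a Dim \<Rightarrow> 'a Dim \<Rightarrow> 'a Dim" is "(+)"
  by (metis add.commute dim_cong.add dim_cong.trans)

instance
  by (standard; transfer) (simp_all add: ac_simps dim_cong.refl)

end

lift_definition Delta :: "'a::lattice \<Rightarrow> 'a \<Rightarrow> 'a Dim" is "\<lambda>a b. {#ivl a b#}" .

lemma Delta_D0: "Delta a a = 0"
  by transfer (rule dim_cong.D0)

lemma Delta_D1: "a \<le> b \<Longrightarrow> b \<le> c \<Longrightarrow> Delta a c = Delta a b + Delta b c"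
  by transfer (rule dim_cong.D1)

lemma Delta_D2: "Delta a (sup a b) = Delta (inf a b) b"
  by transfer (rule dim_cong.D2)

end

theory Submission imports Defs begin

text \<open>
  Let \<open>M = Dim L\<close>, and let \<open>E\<close> be the set of all \<open>\<Delta>(a,b)\<close> with \<open>a\<close> covered by \<open>b\<close>. As bounded chains
  are finite, \<open>E\<close> generates \<open>M\<close>. The point is that the only relations between elements of \<open>E\<close> are
  the absorptions \<open>u + x = x\<close> (Pierce's primitive monoids): two finite sums over \<open>E\<close> are equal iff,
  after enlarging each of the two multisets by elements that are absorbed by one of its members, they
  become the \<^emph>\<open>same\<close> multiset (\<open>absorption_equiv\<close>).

  The nontrivial direction comes from a map in the opposite direction: send \<open>\<Delta>(a,b)\<close> to the multiset
  of covering steps of a maximal chain from \<open>a\<close> to \<open>b\<close>. It has to respect (D0)--(D2) up to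
  \<open>absorption_equiv\<close>. The key case is a square in which the meet is covered by one side: if
  \<open>u = a \<sqinter> b\<close> is covered by \<open>a\<close> and \<open>v = a \<squnion> b\<close>, then every \<open>x\<close> with \<open>b \<le> x\<close> and \<open>x < v\<close> has the same
  meet and join with \<open>a\<close>, so \<open>\<Delta>(x,v) = \<Delta>(u,a)\<close>; comparing two such equations shows that each step
  of a chain from \<open>b\<close> to \<open>v\<close> except the last one is absorbed by \<open>\<Delta>(u,a)\<close>, and the last one equals it
  (\<open>prime_chain_transpose\<close>). Independence of the chain (\<open>prime_chain_unique\<close>) and (D2)
  (\<open>prime_chain_D2\<close>) follow by induction on intervals, which is well founded in a BCF lattice.

  Once sums over \<open>E\<close> are understood in this way, the algebraic preordering is a comparison of
  multiplicities away from absorbed elements (\<open>alg_le_sum_iff\<close>), and all asserted properties are read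
  off multiplicities. In particular \<open>\<Sum>X \<mapsto> \<infinity>\<close> if \<open>X\<close> absorbs \<open>e\<close>, and \<open>\<Sum>X \<mapsto>\<close> the multiplicity of \<open>e\<close>
  in \<open>X\<close> otherwise, are well-defined homomorphisms to the extended natural numbers, and together they
  determine the order.
\<close>

section \<open>Equality of multisets up to absorption\<close>

lemma absorbed_trans: "x \<lless> y \<Longrightarrow> y \<lless> z \<Longrightarrow> x \<lless> z"
  unfolding absorbed_def by (metis add.assoc)

definition absorbed_by :: "'m::comm_monoid_add multiset \<Rightarrow> 'm set" where
  "absorbed_by X = {e. \<exists>x\<in>#X. e \<lless> x}"

definition absorption_equiv :: "'m::comm_monoid_add multiset \<Rightarrow> 'm multiset \<Rightarrow> bool" where
  "absorption_equiv X Y \<longleftrightarrow>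
     (\<exists>U W. X + U = Y + W \<and> set_mset U \<subseteq> absorbed_by X \<and> set_mset W \<subseteq> absorbed_by Y)"

lemma absorbed_by_plus [simp]: "absorbed_by (X + Y) = absorbed_by X \<union> absorbed_by Y"
  by (auto simp: absorbed_by_def)

lemma absorbed_by_subset:
  "set_mset U \<subseteq> absorbed_by X \<Longrightarrow> absorbed_by U \<subseteq> absorbed_by X"
  unfolding absorbed_by_def using absorbed_trans by blast

lemma absorbed_sum:
  assumes "set_mset U \<subseteq> absorbed_by X"
  shows "sum_mset U \<lless> sum_mset X"
  using assms
proof (induction U)
  case empty
  then show ?case by (simp add: absorbed_def)
next
  case (add u U)
  then obtain x where x: "x \<in># X" "u + x = x"
    by (auto simp: absorbed_by_def absorbed_def)
  then obtain X' where X: "X = add_mset x X'" by (meson mset_add)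
  have "u + sum_mset X = sum_mset X"
    unfolding X using x by (simp flip: add.assoc)
  then show ?case
    using add by (simp add: absorbed_def add.assoc)
qed

lemma absorption_equiv_refl: "absorption_equiv X X"
  unfolding absorption_equiv_def by (rule exI[of _ "{#}"])+ simp

lemma absorption_equiv_sym: "absorption_equiv X Y \<Longrightarrow> absorption_equiv Y X"
  unfolding absorption_equiv_def by metis

lemma absorption_equiv_trans [trans]:
  assumes "absorption_equiv X Y" "absorption_equiv Y Z"
  shows "absorption_equiv X Z"
proof -
  obtain U W where 1: "X + U = Y + W" "set_mset U \<subseteq> absorbed_by X" "set_mset W \<subseteq> absorbed_by Y"
    using assms(1) unfolding absorption_equiv_def by blast
  obtain U' W' where 2: "Y + U' = Z + W'" "set_mset U' \<subseteq> absorbed_by Y" "set_mset W' \<subseteq> absorbed_by Z"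
    using assms(2) unfolding absorption_equiv_def by blast
  have eq: "X + (U + U') = Z + (W' + W)"
    using 1(1) 2(1) by (metis add.assoc add.commute)
  have "absorbed_by Y \<subseteq> absorbed_by X"
    using arg_cong[OF 1(1), of absorbed_by] absorbed_by_subset[OF 1(2)] by auto
  moreover have "absorbed_by Y \<subseteq> absorbed_by Z"
    using arg_cong[OF 2(1), of absorbed_by] absorbed_by_subset[OF 2(3)] by auto
  ultimately have "set_mset (U + U') \<subseteq> absorbed_by X" "set_mset (W' + W) \<subseteq> absorbed_by Z"
    using 1(2,3) 2(2,3) by auto
  with eq show ?thesis unfolding absorption_equiv_def by blast
qed

lemma absorption_equiv_add:
  assumes "absorption_equiv X Y"
  shows "absorption_equiv (X + Z) (Y + Z)"
proof -
  obtain U W where "X + U = Y + W" "set_mset U \<subseteq> absorbed_by X" "set_mset W \<subseteq> absorbed_by Y"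
    using assms unfolding absorption_equiv_def by blast
  then have "X + Z + U = Y + Z + W" "set_mset U \<subseteq> absorbed_by (X + Z)"
      "set_mset W \<subseteq> absorbed_by (Y + Z)"
    by (auto simp: add.assoc add.commute[of Z])
  then show ?thesis
    unfolding absorption_equiv_def by blast
qed

lemma absorption_equiv_plus:
  assumes "absorption_equiv X Y" "absorption_equiv X' Y'"
  shows "absorption_equiv (X + X') (Y + Y')"
proof -
  have "absorption_equiv (X + X') (Y + X')" using assms(1) by (rule absorption_equiv_add)
  also have "absorption_equiv (Y + X') (Y + Y')"
    using absorption_equiv_add[OF assms(2), of Y] by (simp add: add.commute)
  finally show ?thesis .
qed

lemma absorption_equiv_absorb:
  "set_mset U \<subseteq> absorbed_by X \<Longrightarrow> absorption_equiv (X + U) X"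
  unfolding absorption_equiv_def by (rule exI[of _ "{#}"], rule exI[of _ U]) simp

section \<open>Monoids presented by absorption relations\<close>

text \<open>
  By \<open>absorbed_sum\<close>, absorption-equivalent multisets have equal sums in every commutative monoid; the
  assumption \<open>sum_eqD\<close> says that there are no other coincidences between sums over \<open>E\<close>.
\<close>

locale absorption_presented =
  fixes E :: "'m::comm_monoid_add set"
  assumes generates: "\<exists>X. set_mset X \<subseteq> E \<and> sum_mset X = m"
    and sum_eqD: "set_mset X \<subseteq> E \<Longrightarrow> set_mset Y \<subseteq> E \<Longrightarrow> sum_mset X = sum_mset Y \<Longrightarrow>
      absorption_equiv X Y"
begin

text \<open>
  Absorbed members of \<open>X\<close> cost nothing below \<open>\<Sum>Y\<close>, and all other members must literally occur in \<open>Y\<close>,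
  because the elements added to \<open>Y\<close> in an absorption equivalence are absorbed by \<open>Y\<close>.
\<close>

lemma alg_le_sum_iff:
  assumes "set_mset X \<subseteq> E" "set_mset Y \<subseteq> E"
  shows "sum_mset X \<preceq> sum_mset Y \<longleftrightarrow> (\<forall>e. e \<notin> absorbed_by Y \<longrightarrow> count X e \<le> count Y e)"
proof
  assume "sum_mset X \<preceq> sum_mset Y"
  then obtain z where z: "sum_mset X + z = sum_mset Y" unfolding alg_le_def by blast
  obtain V where V: "set_mset V \<subseteq> E" "sum_mset V = z" using generates by blast
  have "absorption_equiv (X + V) Y"
    using assms V z by (intro sum_eqD) auto
  then obtain U W where UW: "X + V + U = Y + W" "set_mset W \<subseteq> absorbed_by Y"
    unfolding absorption_equiv_def by blast
  show "\<forall>e. e \<notin> absorbed_by Y \<longrightarrow> count X e \<le> count Y e"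
  proof (intro allI impI)
    fix e assume "e \<notin> absorbed_by Y"
    then have "count W e = 0" using UW(2) by (meson not_in_iff subsetD)
    then show "count X e \<le> count Y e"
      using arg_cong[OF UW(1), of "\<lambda>N. count N e"] by simp
  qed
next
  assume le: "\<forall>e. e \<notin> absorbed_by Y \<longrightarrow> count X e \<le> count Y e"
  let ?X1 = "filter_mset (\<lambda>e. e \<notin> absorbed_by Y) X"
  let ?X2 = "filter_mset (\<lambda>e. e \<in> absorbed_by Y) X"
  have X: "sum_mset X = sum_mset ?X2 + sum_mset ?X1"
    using multiset_partition[of X "\<lambda>e. e \<in> absorbed_by Y"] by (metis sum_mset.union)
  have "?X1 \<subseteq># Y" using le by (auto simp: subseteq_mset_def)
  then obtain Z where Z: "Y = ?X1 + Z" by (metis subset_mset.le_iff_add)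
  have "sum_mset ?X2 + sum_mset Y = sum_mset Y"
    using absorbed_sum[of ?X2 Y] by (auto simp: absorbed_def)
  moreover have "sum_mset Y = sum_mset ?X1 + sum_mset Z"
    using arg_cong[OF Z, of sum_mset] by simp
  ultimately have "sum_mset X + sum_mset Z = sum_mset Y"
    using X by (metis add.assoc)
  then show "sum_mset X \<preceq> sum_mset Y" unfolding alg_le_def by blast
qed

lemma antisymmetric: "antisymmetric_monoid TYPE('m)"
  unfolding antisymmetric_monoid_def
proof (intro allI impI, elim conjE)
  fix x y :: 'm assume le: "x \<preceq> y" "y \<preceq> x"
  obtain X where X: "set_mset X \<subseteq> E" "sum_mset X = x" using generates by blast
  obtain Y where Y: "set_mset Y \<subseteq> E" "sum_mset Y = y" using generates by blast
  have XY: "e \<notin> absorbed_by Y \<Longrightarrow> count X e \<le> count Y e" for e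
    using alg_le_sum_iff[OF X(1) Y(1)] X Y le by auto
  have YX: "e \<notin> absorbed_by X \<Longrightarrow> count Y e \<le> count X e" for e
    using alg_le_sum_iff[OF Y(1) X(1)] X Y le by auto
  have sub: "absorbed_by A \<subseteq> absorbed_by B"
    if "\<And>e. e \<notin> absorbed_by B \<Longrightarrow> count A e \<le> count B e" for A B :: "'m multiset"
  proof
    fix e assume "e \<in> absorbed_by A"
    then obtain a where a: "a \<in># A" "e \<lless> a" by (auto simp: absorbed_by_def)
    show "e \<in> absorbed_by B"
    proof (cases "a \<in> absorbed_by B")
      case True
      then show ?thesis using a(2) absorbed_trans by (auto simp: absorbed_by_def)
    next
      case False
      then have "a \<in># B" using that[of a] a(1) by (metis count_greater_zero_iff order_less_le_trans)
      then show ?thesis using a(2) by (auto simp: absorbed_by_def)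
    qed
  qed
  have D: "absorbed_by X = absorbed_by Y"
    using sub[of Y X] sub[of X Y] XY YX by blast
  let ?X2 = "filter_mset (\<lambda>e. e \<in> absorbed_by Y) X"
  let ?Y2 = "filter_mset (\<lambda>e. e \<in> absorbed_by X) Y"
  have "X + ?Y2 = Y + ?X2"
  proof (rule multiset_eqI)
    fix e show "count (X + ?Y2) e = count (Y + ?X2) e"
      using XY[of e] YX[of e] by (auto simp: D)
  qed
  then have "sum_mset X + sum_mset ?Y2 = sum_mset Y + sum_mset ?X2"
    by (metis sum_mset.union)
  moreover have "sum_mset ?Y2 + sum_mset X = sum_mset X"
    using absorbed_sum[of ?Y2 X] by (auto simp: absorbed_def)
  moreover have "sum_mset ?X2 + sum_mset Y = sum_mset Y"
    using absorbed_sum[of ?X2 Y] by (auto simp: absorbed_def)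
  ultimately show "x = y" using X Y by (simp add: add.commute)
qed

text \<open>
  An element added to \<open>A\<^sub>0 + A\<^sub>1\<close> is absorbed by \<open>A\<^sub>0\<close> or by \<open>A\<^sub>1\<close>, so it can be charged to that summand
  without changing its sum. This reduces refinement in the monoid to refinement of multisets.
\<close>

lemma refinement: "refinement_monoid TYPE('m)"
  unfolding refinement_monoid_def
proof (intro allI impI)
  have split: "\<exists>U0 U1. U = U0 + U1 \<and> set_mset U0 \<subseteq> absorbed_by A0 \<and> set_mset U1 \<subseteq> absorbed_by A1"
    if "set_mset U \<subseteq> absorbed_by (A0 + A1)" for U A0 A1 :: "'m multiset"
  proof -
    have "U = filter_mset (\<lambda>e. e \<in> absorbed_by A0) U + filter_mset (\<lambda>e. e \<notin> absorbed_by A0) U"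
      by (rule multiset_partition)
    moreover have "set_mset (filter_mset (\<lambda>e. e \<notin> absorbed_by A0) U) \<subseteq> absorbed_by A1"
      using that by auto
    moreover have "set_mset (filter_mset (\<lambda>e. e \<in> absorbed_by A0) U) \<subseteq> absorbed_by A0" by auto
    ultimately show ?thesis by blast
  qed
  fix a0 a1 b0 b1 :: 'm assume eq: "a0 + a1 = b0 + b1"
  obtain A0 where A0: "set_mset A0 \<subseteq> E" "sum_mset A0 = a0" using generates by blast
  obtain A1 where A1: "set_mset A1 \<subseteq> E" "sum_mset A1 = a1" using generates by blast
  obtain B0 where B0: "set_mset B0 \<subseteq> E" "sum_mset B0 = b0" using generates by blast
  obtain B1 where B1: "set_mset B1 \<subseteq> E" "sum_mset B1 = b1" using generates by blast
  have "absorption_equiv (A0 + A1) (B0 + B1)"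
    using A0 A1 B0 B1 eq by (intro sum_eqD) auto
  then obtain U W where UW: "A0 + A1 + U = B0 + B1 + W" "set_mset U \<subseteq> absorbed_by (A0 + A1)"
      "set_mset W \<subseteq> absorbed_by (B0 + B1)"
    unfolding absorption_equiv_def by blast
  obtain U0 U1 where U: "U = U0 + U1" "set_mset U0 \<subseteq> absorbed_by A0" "set_mset U1 \<subseteq> absorbed_by A1"
    using split[OF UW(2)] by blast
  obtain W0 W1 where W: "W = W0 + W1" "set_mset W0 \<subseteq> absorbed_by B0" "set_mset W1 \<subseteq> absorbed_by B1"
    using split[OF UW(3)] by blast
  define P0 P1 Q0 Q1 where "P0 = A0 + U0" "P1 = A1 + U1" "Q0 = B0 + W0" "Q1 = B1 + W1"
  note defs = this
  have sums: "sum_mset P0 = a0" "sum_mset P1 = a1" "sum_mset Q0 = b0" "sum_mset Q1 = b1"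
    using absorbed_sum[OF U(2)] absorbed_sum[OF U(3)] absorbed_sum[OF W(2)] absorbed_sum[OF W(3)]
      A0 A1 B0 B1
    by (simp_all add: absorbed_def defs add.commute)
  have PQ: "P0 + P1 = Q0 + Q1"
    using UW(1) by (simp add: U(1) W(1) defs ac_simps)
  define C00 C01 C10 C11
    where "C00 = P0 \<inter># Q0" "C01 = P0 - C00" "C10 = Q0 - C00" "C11 = P1 - C10"
  note C = this
  have cnt: "count P0 e + count P1 e = count Q0 e + count Q1 e" for e
    using arg_cong[OF PQ, of "\<lambda>N. count N e"] by simp
  have "P0 = C00 + C01" "Q0 = C00 + C10"
    by (rule multiset_eqI; simp add: C)+
  moreover have "count P1 e = count (C10 + C11) e" "count Q1 e = count (C01 + C11) e" for e
    using cnt[of e] by (auto simp: C min_def)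
  then have "P1 = C10 + C11" "Q1 = C01 + C11"
    by (simp_all add: multiset_eqI)
  ultimately have "a0 = sum_mset C00 + sum_mset C01 \<and> a1 = sum_mset C10 + sum_mset C11 \<and>
      b0 = sum_mset C00 + sum_mset C10 \<and> b1 = sum_mset C01 + sum_mset C11"
    by (simp flip: sums)
  then show "\<exists>c00 c01 c10 c11. a0 = c00 + c01 \<and> a1 = c10 + c11 \<and> b0 = c00 + c10 \<and> b1 = c01 + c11"
    by blast
qed

lemma interval: "interval_axiom TYPE('m)"
  unfolding interval_axiom_def
proof (intro allI impI, elim conjE)
  fix x y0 y1 z :: 'm assume le: "z \<preceq> x + y0" "z \<preceq> x + y1"
  obtain X where X: "set_mset X \<subseteq> E" "sum_mset X = x" using generates by blast
  obtain Y0 where Y0: "set_mset Y0 \<subseteq> E" "sum_mset Y0 = y0" using generates by blast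
  obtain Y1 where Y1: "set_mset Y1 \<subseteq> E" "sum_mset Y1 = y1" using generates by blast
  obtain Z where Z: "set_mset Z \<subseteq> E" "sum_mset Z = z" using generates by blast
  \<comment> \<open>The least multiset that \<open>X\<close> lacks to dominate \<open>Z\<close>, which is therefore below both \<open>Y0\<close> and \<open>Y1\<close>.\<close>
  define Y where "Y = filter_mset (\<lambda>e. e \<notin> absorbed_by X) (Z - X)"
  have YE: "set_mset Y \<subseteq> E" using Z(1) in_diffD unfolding Y_def set_mset_filter by fast
  have below: "sum_mset Y \<preceq> sum_mset V"
    if V: "set_mset V \<subseteq> E" and "sum_mset Z \<preceq> sum_mset (X + V)" for V
  proof -
    have "count Z e \<le> count X e + count V e" if "e \<notin> absorbed_by X" "e \<notin> absorbed_by V" for e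
      using alg_le_sum_iff[of Z "X + V"] that X Z V \<open>sum_mset Z \<preceq> sum_mset (X + V)\<close> by auto
    then show ?thesis
      unfolding alg_le_sum_iff[OF YE V] by (auto simp: Y_def) (metis le_diff_conv add.commute)
  qed
  have "sum_mset Z \<preceq> sum_mset (X + Y)"
    using X YE by (subst alg_le_sum_iff[OF Z(1)]) (auto simp: Y_def)
  then show "\<exists>y. y \<preceq> y0 \<and> y \<preceq> y1 \<and> z \<preceq> x + y"
    using below[OF Y0(1)] below[OF Y1(1)] X Y0 Y1 Z le by auto
qed

lemma pseudo_cancel: "pseudo_cancellation TYPE('m)"
  unfolding pseudo_cancellation_def
proof (intro allI impI)
  fix x y z :: 'm assume le: "x + z \<preceq> y + z"
  obtain X where X: "set_mset X \<subseteq> E" "sum_mset X = x" using generates by blast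
  obtain Y where Y: "set_mset Y \<subseteq> E" "sum_mset Y = y" using generates by blast
  obtain Z where Z: "set_mset Z \<subseteq> E" "sum_mset Z = z" using generates by blast
  define T where "T = filter_mset (\<lambda>e. e \<in> absorbed_by Z) X"
  have TE: "set_mset T \<subseteq> E" using X(1) by (auto simp: T_def)
  have "count X e \<le> count Y e" if "e \<notin> absorbed_by Y" "e \<notin> absorbed_by Z" for e
    using alg_le_sum_iff[of "X + Z" "Y + Z"] that X Y Z le by auto
  then have "sum_mset X \<preceq> sum_mset (Y + T)"
    using X Y TE by (subst alg_le_sum_iff) (auto simp: T_def)
  moreover have "sum_mset T \<lless> z"
    unfolding Z(2)[symmetric] by (rule absorbed_sum) (auto simp: T_def)
  ultimately show "\<exists>t. t \<lless> z \<and> x \<preceq> y + t" using X Y by auto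
qed

definition multiplicity_in :: "'m \<Rightarrow> 'm multiset \<Rightarrow> enat" where
  "multiplicity_in e X = (if e \<in> absorbed_by X then \<infinity> else enat (count X e))"

lemma multiplicity_in_plus: "multiplicity_in e (X + Y) = multiplicity_in e X + multiplicity_in e Y"
  by (auto simp: multiplicity_in_def)

lemma multiplicity_in_absorb:
  assumes "set_mset U \<subseteq> absorbed_by X"
  shows "multiplicity_in e (X + U) = multiplicity_in e X"
  using assms absorbed_by_subset[OF assms] by (auto simp: multiplicity_in_def not_in_iff[symmetric])

lemma multiplicity_in_cong:
  assumes "set_mset X \<subseteq> E" "set_mset Y \<subseteq> E" "sum_mset X = sum_mset Y"
  shows "multiplicity_in e X = multiplicity_in e Y"
proof -
  obtain U W where "X + U = Y + W" "set_mset U \<subseteq> absorbed_by X" "set_mset W \<subseteq> absorbed_by Y"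
    using sum_eqD[OF assms] unfolding absorption_equiv_def by blast
  then show ?thesis using multiplicity_in_absorb by metis
qed

definition multiplicity :: "'m \<Rightarrow> 'm \<Rightarrow> enat" where
  "multiplicity e x = multiplicity_in e (SOME X. set_mset X \<subseteq> E \<and> sum_mset X = x)"

lemma multiplicity_sum:
  assumes "set_mset X \<subseteq> E"
  shows "multiplicity e (sum_mset X) = multiplicity_in e X"
proof -
  let ?R = "SOME Y. set_mset Y \<subseteq> E \<and> sum_mset Y = sum_mset X"
  have "set_mset ?R \<subseteq> E \<and> sum_mset ?R = sum_mset X"
    by (rule someI[of _ X]) (simp add: assms)
  then show ?thesis
    unfolding multiplicity_def using multiplicity_in_cong assms by blast
qed

lemma multiplicity_0: "multiplicity e 0 = 0"
  using multiplicity_sum[of "{#}" e]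
  by (simp add: multiplicity_in_def absorbed_by_def zero_enat_def)

lemma multiplicity_add: "multiplicity e (x + y) = multiplicity e x + multiplicity e y"
proof -
  obtain X where X: "set_mset X \<subseteq> E" "sum_mset X = x" using generates by blast
  obtain Y where Y: "set_mset Y \<subseteq> E" "sum_mset Y = y" using generates by blast
  show ?thesis
    using multiplicity_sum[of "X + Y" e] multiplicity_sum[OF X(1), of e]
      multiplicity_sum[OF Y(1), of e] X Y
    by (simp add: multiplicity_in_plus)
qed

lemma alg_le_if_multiplicity_le:
  assumes "\<And>e. multiplicity e x \<le> multiplicity e y"
  shows "x \<preceq> y"
proof -
  obtain X where X: "set_mset X \<subseteq> E" "sum_mset X = x" using generates by blast
  obtain Y where Y: "set_mset Y \<subseteq> E" "sum_mset Y = y" using generates by blast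
  have "multiplicity_in e X \<le> multiplicity_in e Y" for e
    using assms[of e] multiplicity_sum X Y by metis
  then have "count X e \<le> count Y e" if "e \<notin> absorbed_by Y" for e
    using that by (metis enat_ord_code(5) enat_ord_simps(1) multiplicity_in_def)
  then show ?thesis using alg_le_sum_iff[OF X(1) Y(1)] X Y by auto
qed

text \<open>
  Evaluation at \<^emph>\<open>all\<close> homomorphisms to the extended natural numbers is used as the embedding; the
  multiplicities are among its coordinates.
\<close>

lemma embeds: "embeds_in_enat_power TYPE('m)"
proof -
  define hom where "hom c \<longleftrightarrow> c 0 = 0 \<and> (\<forall>x y. c (x + y) = c x + c y)" for c :: "'m \<Rightarrow> enat"
  define f where "f x c = (if hom c then c x else 0)" for x :: 'm and c
  have mono: "f x \<le> f y" if "x \<preceq> y" for x y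
    using that by (auto simp: le_fun_def f_def hom_def alg_le_def)
  have refl: "x \<preceq> y" if "f x \<le> f y" for x y
  proof (rule alg_le_if_multiplicity_le)
    fix e
    have "hom (multiplicity e)" by (simp add: hom_def multiplicity_0 multiplicity_add)
    then show "multiplicity e x \<le> multiplicity e y"
      using le_funD[OF that, of "multiplicity e"] by (simp add: f_def)
  qed
  have "inj f"
    using antisymmetric refl by (auto intro!: injI simp: antisymmetric_monoid_def)
  moreover have "f 0 = 0" "f (x + y) = f x + f y" for x y
    by (auto simp: f_def hom_def fun_eq_iff)
  ultimately have "enat_power_embedding f"
    unfolding enat_power_embedding_def using mono refl by blast
  then show ?thesis unfolding embeds_in_enat_power_def by blast
qed

end

section \<open>Maximal chains in a BCF lattice\<close>

definition covered_by :: "'a::order \<Rightarrow> 'a \<Rightarrow> bool" where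
  "covered_by a b \<longleftrightarrow> a < b \<and> (\<forall>c. a \<le> c \<and> c \<le> b \<longrightarrow> c = a \<or> c = b)"

text \<open>
  The multiset records the values \<open>\<Delta>\<close> of the covering steps in \<open>Dim L\<close>, not the steps themselves, so
  that absorption between steps is the one of \<open>Dim L\<close>.
\<close>

inductive prime_chain :: "'a::lattice \<Rightarrow> 'a \<Rightarrow> 'a Dim multiset \<Rightarrow> bool" where
  Nil: "prime_chain a a {#}"
| Cons: "covered_by a x \<Longrightarrow> prime_chain x b X \<Longrightarrow> prime_chain a b (add_mset (Delta a x) X)"

lemma prime_chain_le: "prime_chain a b X \<Longrightarrow> a \<le> b"
  by (induction rule: prime_chain.induct) (auto simp: covered_by_def intro: order_trans less_imp_le)

lemma prime_chain_append:
  "prime_chain a b X \<Longrightarrow> prime_chain b c Y \<Longrightarrow> prime_chain a c (X + Y)"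
  by (induction rule: prime_chain.induct) (auto intro: prime_chain.intros)

lemma prime_chain_sum: "prime_chain a b X \<Longrightarrow> sum_mset X = Delta a b"
proof (induction rule: prime_chain.induct)
  case (Nil a)
  then show ?case by (simp add: Delta_D0)
next
  case (Cons a x b X)
  then show ?case
    using Delta_D1[of a x b] prime_chain_le[of x b X] by (auto simp: covered_by_def)
qed

lemma prime_chain_step:
  "prime_chain a b X \<Longrightarrow> e \<in># X \<Longrightarrow> \<exists>x y. a \<le> x \<and> covered_by x y \<and> y \<le> b \<and> e = Delta x y"
proof (induction rule: prime_chain.induct)
  case (Nil a)
  then show ?case by simp
next
  case (Cons a x b X)
  have ax: "a \<le> x" "x \<le> b"
    using Cons.hyps prime_chain_le by (auto simp: covered_by_def)
  show ?case
  proof (cases "e = Delta a x")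
    case True
    then show ?thesis using ax Cons.hyps(1) by blast
  next
    case False
    then show ?thesis using Cons.IH Cons.prems ax(1) by (auto intro: order_trans)
  qed
qed

lemma prime_chain_same: "prime_chain a a X \<Longrightarrow> X = {#}"
  by (erule prime_chain.cases) (auto simp: covered_by_def dest!: prime_chain_le)

lemma prime_chain_cover: "covered_by a b \<Longrightarrow> prime_chain a b X \<Longrightarrow> X = {#Delta a b#}"
  by (erule prime_chain.cases)
    (auto simp: covered_by_def dest: prime_chain_le prime_chain_same order.strict_implies_order)

definition subinterval_rel :: "(('a::order \<times> 'a) \<times> ('a \<times> 'a)) set" where
  "subinterval_rel =
     {((a', b'), (a, b)). a \<le> a' \<and> a' \<le> b' \<and> b' \<le> b \<and> (a, b) \<noteq> (a', b')}"

text \<open>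
  In an infinite decreasing sequence of intervals, the lower endpoints form a bounded chain, and so do
  the upper endpoints. Both are finite, which leaves only finitely many intervals.
\<close>

lemma wf_subinterval_rel:
  assumes "bcf TYPE('a::order)"
  shows "wf (subinterval_rel :: (('a \<times> 'a) \<times> ('a \<times> 'a)) set)"
  unfolding wf_iff_no_infinite_down_chain
proof
  assume "\<exists>f :: nat \<Rightarrow> 'a \<times> 'a. \<forall>i. (f (Suc i), f i) \<in> subinterval_rel"
  then obtain f :: "nat \<Rightarrow> 'a \<times> 'a" where f: "\<And>i. (f (Suc i), f i) \<in> subinterval_rel" by blast
  define a b where "a i = fst (f (Suc i))" and "b i = snd (f (Suc i))" for i
  have step: "a i \<le> a (Suc i)" "b (Suc i) \<le> b i" "(a i, b i) \<noteq> (a (Suc i), b (Suc i))"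
    and ab: "a i \<le> b i" for i
    using f[of "Suc i"] f[of i] by (auto simp: subinterval_rel_def a_def b_def split: prod.splits)
  have a_mono: "a i \<le> a j" and b_mono: "b j \<le> b i" if "i \<le> j" for i j
    using that lift_Suc_mono_le[of a i j] lift_Suc_antimono_le[of b i j] step by auto
  have "a 0 \<le> a i \<and> a i \<le> b 0" "a 0 \<le> b i \<and> b i \<le> b 0" for i
    using a_mono[of 0 i] b_mono[of 0 i] ab[of i] by (auto intro: order_trans)
  then have "bdd_below (range a)" "bdd_above (range a)" "bdd_below (range b)" "bdd_above (range b)"
    by (auto intro!: bdd_belowI[of _ "a 0"] bdd_aboveI[of _ "b 0"])
  moreover have "Complete_Partial_Order.chain (\<le>) (range a)"
    by (rule chainI) (use a_mono nat_le_linear in blast)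
  moreover have "Complete_Partial_Order.chain (\<le>) (range b)"
    by (rule chainI) (use b_mono nat_le_linear in blast)
  ultimately have "finite (range a)" "finite (range b)"
    using assms unfolding bcf_def by blast+
  then have "finite (range a \<times> range b)" by simp
  then have "finite (range (\<lambda>i. (a i, b i)))" by (rule rev_finite_subset) auto
  moreover have "inj (\<lambda>i. (a i, b i))"
  proof (rule linorder_injI)
    fix i j :: nat assume "i < j"
    show "(a i, b i) \<noteq> (a j, b j)"
    proof
      assume "(a i, b i) = (a j, b j)"
      then have eq: "a j = a i" "b j = b i" by simp_all
      have "Suc i \<le> j" using \<open>i < j\<close> by simp
      then have "a (Suc i) \<le> a i" "b i \<le> b (Suc i)"
        using a_mono[of "Suc i" j] b_mono[of "Suc i" j] unfolding eq by blast+
      then have "a (Suc i) = a i" "b (Suc i) = b i"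
        using step(1,2)[of i] by (blast intro: order.antisym)+
      then show False using step(3)[of i] by simp
    qed
  qed
  ultimately show False using finite_imageD by blast
qed

lemma interval_induct [consumes 2, case_names interval]:
  fixes a b :: "'a::order"
  assumes "bcf TYPE('a)" "a \<le> b"
    and step: "\<And>a b. a \<le> b \<Longrightarrow>
      (\<And>a' b'. a \<le> a' \<Longrightarrow> a' \<le> b' \<Longrightarrow> b' \<le> b \<Longrightarrow> (a, b) \<noteq> (a', b') \<Longrightarrow> P a' b') \<Longrightarrow> P a b"
  shows "P a b"
proof -
  have "fst p \<le> snd p \<longrightarrow> P (fst p) (snd p)" for p :: "'a \<times> 'a"
  proof (induction p rule: wf_induct_rule[OF wf_subinterval_rel[OF assms(1)]])
    case (1 p)
    show ?case
    proof
      assume "fst p \<le> snd p"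
      then show "P (fst p) (snd p)"
      proof (rule step)
        fix a' b' assume "fst p \<le> a'" "a' \<le> b'" "b' \<le> snd p" "(fst p, snd p) \<noteq> (a', b')"
        then show "P a' b'"
          using 1[of "(a', b')"] by (cases p) (auto simp: subinterval_rel_def)
      qed
    qed
  qed
  then show ?thesis using assms(2) by (metis fst_conv snd_conv)
qed

lemma prime_chain_exists:
  fixes a b :: "'a::lattice"
  assumes "bcf TYPE('a)" "a \<le> b"
  shows "\<exists>X. prime_chain a b X"
  using assms
proof (induction rule: interval_induct)
  case (interval a b)
  consider "a = b" | "covered_by a b" | c where "a < c" "c < b"
    using interval.hyps by (auto simp: covered_by_def order.order_iff_strict)
  then show ?case
  proof cases
    case 1
    then show ?thesis using prime_chain.Nil by blast
  next
    case 2
    then show ?thesis using prime_chain.Cons prime_chain.Nil by blast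
  next
    case 3
    have "\<exists>X. prime_chain a c X" by (rule interval.IH) (use 3 in auto)
    moreover have "\<exists>Y. prime_chain c b Y" by (rule interval.IH) (use 3 in auto)
    ultimately show ?thesis using prime_chain_append by blast
  qed
qed

text \<open>
  Moving \<open>b\<close> up a chain towards \<open>v\<close> leaves its meet \<open>u\<close> with \<open>a\<close> unchanged, as \<open>u\<close> is covered by \<open>a\<close>,
  until \<open>v\<close> itself is reached. So each step \<open>[b,x]\<close> other than the last satisfies
  \<open>\<Delta>(b,x) + \<Delta>(u,a) = \<Delta>(b,x) + \<Delta>(x,v) = \<Delta>(b,v) = \<Delta>(u,a)\<close>.
\<close>

lemma prime_chain_transpose:
  assumes "prime_chain b v Y" "covered_by u a" "inf a b = u" "sup a b = v"
  shows "absorption_equiv Y {#Delta u a#}"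
  using assms
proof (induction rule: prime_chain.induct)
  case (Nil v)
  then show ?case by (auto simp: covered_by_def inf_absorb1 le_iff_sup sup_commute)
next
  case (Cons b x v Y)
  have x: "b \<le> x" "x \<le> v" using Cons.hyps prime_chain_le by (auto simp: covered_by_def)
  have bv: "Delta b v = Delta u a"
    using Delta_D2[of b a] Cons.prems by (simp add: inf_commute sup_commute)
  have "u \<le> inf a x" using Cons.prems x by (auto intro: le_infI2)
  then consider "inf a x = u" | "inf a x = a"
    using Cons.prems(1) unfolding covered_by_def by (metis inf.cobounded1)
  then show ?case
  proof cases
    case 1
    have v: "sup a x = v"
    proof (rule antisym)
      show "sup a x \<le> v" using x(2) Cons.prems(3) by auto
      show "v \<le> sup a x" using x(1) Cons.prems(3) by (metis sup.mono order.refl)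
    qed
    have "Delta x v = Delta u a"
      using Delta_D2[of x a] 1 v by (simp add: inf_commute sup_commute)
    then have "Delta b x + Delta u a = Delta u a"
      using Delta_D1[OF x] bv by simp
    then have "absorption_equiv ({#Delta u a#} + {#Delta b x#}) {#Delta u a#}"
      by (intro absorption_equiv_absorb) (simp add: absorbed_by_def absorbed_def)
    moreover have "absorption_equiv (Y + {#Delta b x#}) ({#Delta u a#} + {#Delta b x#})"
      using Cons.IH[OF Cons.prems(1) 1 v] by (rule absorption_equiv_add)
    ultimately show ?thesis using absorption_equiv_trans by fastforce
  next
    case 2
    then have "x = v" using x Cons.prems(3) by (metis antisym inf.cobounded2 le_supI)
    then have "Y = {#}" using Cons.hyps(2) prime_chain_same by blast
    then show ?thesis using bv \<open>x = v\<close> by (simp add: absorption_equiv_refl)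
  qed
qed

text \<open>
  A Jordan--Hoelder argument. Two chains with different first steps \<open>[a,x]\<close> and \<open>[a,y]\<close> are compared
  through \<open>x \<squnion> y\<close>; transposing, the steps from \<open>x\<close> to \<open>x \<squnion> y\<close> amount to \<open>\<Delta>(a,y)\<close> and those from \<open>y\<close> to
  \<open>x \<squnion> y\<close> amount to \<open>\<Delta>(a,x)\<close>.
\<close>

lemma prime_chain_unique:
  fixes a b :: "'a::lattice"
  assumes bcf: "bcf TYPE('a)" and "prime_chain a b X" "prime_chain a b Y"
  shows "absorption_equiv X Y"
proof -
  have "a \<le> b" using assms(2) by (rule prime_chain_le)
  with bcf show ?thesis using assms(2,3)
  proof (induction arbitrary: X Y rule: interval_induct)
    case (interval a b)
    from interval.prems(1) show ?case
    proof (cases rule: prime_chain.cases)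
      case Nil
      then show ?thesis
        using interval.prems prime_chain_same absorption_equiv_refl by metis
    next
      case X: (Cons x X')
      from interval.prems(2) show ?thesis
      proof (cases rule: prime_chain.cases)
        case Nil
        then show ?thesis
          using interval.prems prime_chain_same absorption_equiv_refl by metis
      next
        case Y: (Cons y Y')
        have ax: "a < x" "x \<le> b" and ay: "a < y" "y \<le> b"
          using X Y prime_chain_le by (auto simp: covered_by_def)
        show ?thesis
        proof (cases "x = y")
          case True
          have "absorption_equiv X' Y'"
            using interval.IH[of x b X' Y'] X Y ax True by auto
          then show ?thesis
            using absorption_equiv_add[of X' Y' "{#Delta a x#}"] X Y True by simp
        next
          case False
          define v where "v = sup x y"
          have v: "x \<le> v" "y \<le> v" "v \<le> b" using ax ay by (auto simp: v_def)
          have "a \<le> inf x y" using ax ay by auto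
          then have meet: "inf x y = a"
            using X(2) Y(2) False unfolding covered_by_def
            by (metis inf.cobounded1 inf.cobounded2 order_antisym ax(1) ay(1) less_imp_le)
          obtain S where S: "prime_chain x v S" using prime_chain_exists[OF bcf v(1)] by blast
          obtain R where R: "prime_chain y v R" using prime_chain_exists[OF bcf v(2)] by blast
          obtain T where T: "prime_chain v b T" using prime_chain_exists[OF bcf v(3)] by blast
          have "absorption_equiv X' (S + T)"
            using interval.IH[of x b X' "S + T"] X(3) ax prime_chain_append[OF S T] by auto
          also have "absorption_equiv (S + T) ({#Delta a y#} + T)"
            by (rule absorption_equiv_add, rule prime_chain_transpose[OF S Y(2)])
              (use meet in \<open>simp_all add: v_def inf_commute sup_commute\<close>)
          finally have "absorption_equiv ({#Delta a x#} + X') ({#Delta a x#} + ({#Delta a y#} + T))"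
            by (rule absorption_equiv_plus[OF absorption_equiv_refl])
          then have 1: "absorption_equiv X ({#Delta a x, Delta a y#} + T)"
            by (simp add: X(1) add_mset_commute)
          have "absorption_equiv Y' (R + T)"
            using interval.IH[of y b Y' "R + T"] Y(3) ay prime_chain_append[OF R T] by auto
          also have "absorption_equiv (R + T) ({#Delta a x#} + T)"
            by (rule absorption_equiv_add, rule prime_chain_transpose[OF R X(2)])
              (use meet in \<open>simp_all add: v_def\<close>)
          finally have "absorption_equiv ({#Delta a y#} + Y') ({#Delta a y#} + ({#Delta a x#} + T))"
            by (rule absorption_equiv_plus[OF absorption_equiv_refl])
          then have 2: "absorption_equiv Y ({#Delta a x, Delta a y#} + T)"
            by (simp add: Y(1) add_mset_commute)
          show ?thesis
            using 1 absorption_equiv_sym[OF 2] by (rule absorption_equiv_trans)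
        qed
      qed
    qed
  qed
qed

text \<open>
  Cut the square at \<open>v' = a' \<squnion> b\<close>, where \<open>[a \<sqinter> b, a']\<close> is the first step towards \<open>a\<close>. The upper part is
  a square with larger bottom \<open>a \<sqinter> v'\<close>. In the lower part, every \<open>x\<close> between \<open>a'\<close> and \<open>a \<sqinter> v'\<close> has the
  same meet and join with \<open>b\<close>, so that \<open>\<Delta>(a \<sqinter> b, x)\<close> does not depend on \<open>x\<close> and all steps above \<open>a'\<close>
  are absorbed by \<open>\<Delta>(a \<sqinter> b, a')\<close>.
\<close>

lemma prime_chain_D2:
  fixes a b :: "'a::lattice"
  assumes bcf: "bcf TYPE('a)"
    and "prime_chain (inf a b) a X" "prime_chain b (sup a b) Y"
  shows "absorption_equiv X Y"
proof -
  have "absorption_equiv X Y"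
    if "u \<le> v" "inf a b = u" "sup a b = v" "prime_chain u a X" "prime_chain b v Y" for u v
    using bcf that
  proof (induction arbitrary: a b X Y rule: interval_induct)
    case (interval u v)
    from interval.prems(3) show ?case
    proof (cases rule: prime_chain.cases)
      case Nil
      then have "b = v" using interval.prems by (metis inf.orderI le_iff_sup)
      then show ?thesis
        using Nil interval.prems prime_chain_same absorption_equiv_refl by metis
    next
      case X: (Cons a' X')
      have ua': "u < a'" and a'a: "a' \<le> a"
        using X prime_chain_le by (auto simp: covered_by_def)
      have ub: "u \<le> b" using interval.prems(1) by auto
      define v' where "v' = sup a' b"
      define a'' where "a'' = inf a v'"
      define p where "p = Delta u a'"
      have le: "a' \<le> a''" "a'' \<le> a" "b \<le> v'" "v' \<le> v" "a'' \<le> v'"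
        using a'a interval.prems(2) by (auto simp: a''_def v'_def intro: le_supI1)
      have meet: "inf a' b = u"
      proof (rule antisym)
        show "inf a' b \<le> u" using interval.prems(1) a'a by (metis inf_mono order.refl)
        show "u \<le> inf a' b" using ua' ub by auto
      qed
      have square: "Delta u x = p" if "a' \<le> x" "x \<le> a''" for x
      proof -
        have "inf x b = u"
        proof (rule antisym)
          show "inf x b \<le> u"
            using interval.prems(1) that(2) le(2) by (metis inf_mono order.refl order_trans)
          show "u \<le> inf x b" using that(1) ua' ub by auto
        qed
        moreover have "sup x b = v'"
        proof (rule antisym)
          show "sup x b \<le> v'" using that(2) le by auto
          show "v' \<le> sup x b" unfolding v'_def using that(1) by (metis sup.mono order.refl)
        qed
        ultimately show ?thesis
          using Delta_D2[of b x] Delta_D2[of b a'] meet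
          by (simp add: p_def v'_def inf_commute sup_commute)
      qed
      obtain X1 where X1: "prime_chain a' a'' X1" using prime_chain_exists[OF bcf le(1)] by blast
      obtain X2 where X2: "prime_chain a'' a X2" using prime_chain_exists[OF bcf le(2)] by blast
      obtain Y1 where Y1: "prime_chain b v' Y1" using prime_chain_exists[OF bcf le(3)] by blast
      obtain Y2 where Y2: "prime_chain v' v Y2" using prime_chain_exists[OF bcf le(4)] by blast
      have "e \<lless> p" if e: "e \<in># X1" for e
      proof -
        obtain x y where xy: "a' \<le> x" "x \<le> y" "y \<le> a''" "e = Delta x y"
          using prime_chain_step[OF X1 e] unfolding covered_by_def by (blast intro: less_imp_le)
        then have "Delta u y = Delta u x + Delta x y"
          using ua' by (intro Delta_D1) auto
        then show ?thesis
          using square[of x] square[of y] xy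
          by (metis absorbed_def add.commute order_trans)
      qed
      then have "absorption_equiv ({#p#} + X1) {#p#}"
        by (intro absorption_equiv_absorb) (auto simp: absorbed_by_def)
      moreover have "absorption_equiv Y1 {#p#}"
        unfolding p_def by (rule prime_chain_transpose[OF Y1 X(2) meet]) (simp add: v'_def)
      ultimately have 1: "absorption_equiv ({#p#} + X1) Y1"
        using absorption_equiv_trans absorption_equiv_sym by blast
      have 2: "absorption_equiv X2 Y2"
      proof (rule interval.IH[of a'' v a v'])
        show "u \<le> a''" "(u, v) \<noteq> (a'', v)" using ua' le by auto
        show "a'' \<le> v" "v \<le> v" using le by auto
        show "sup a v' = v"
          using interval.prems(2) a'a by (metis sup.absorb1 sup.assoc v'_def)
      qed (use X2 Y2 in \<open>simp_all add: a''_def\<close>)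
      have "absorption_equiv X (({#p#} + X1) + X2)"
        using prime_chain_append[OF prime_chain.Cons[OF X(2) X1] X2] interval.prems(3)
        by (intro prime_chain_unique[OF bcf, of u a]) (auto simp: p_def)
      also have "absorption_equiv (({#p#} + X1) + X2) (Y1 + Y2)"
        using 1 2 by (rule absorption_equiv_plus)
      also have "absorption_equiv (Y1 + Y2) Y"
        using prime_chain_append[OF Y1 Y2] interval.prems(4) by (rule prime_chain_unique[OF bcf])
      finally show ?thesis .
    qed
  qed
  moreover have "inf a b \<le> sup a b" by (simp add: le_supI1)
  ultimately show ?thesis using assms(2,3) by blast
qed

section \<open>The dimension monoid of a BCF lattice\<close>

definition chosen_chain :: "'a::lattice ivl \<Rightarrow> 'a Dim multiset" where
  "chosen_chain i = (SOME X. prime_chain (fst (Rep_ivl i)) (snd (Rep_ivl i)) X)"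

lemma chosen_chain:
  fixes a b :: "'a::lattice"
  assumes "bcf TYPE('a)" "a \<le> b"
  shows "prime_chain a b (chosen_chain (ivl a b))"
proof -
  have "Rep_ivl (ivl a b) = (a, b)"
    using assms(2) by (simp add: ivl_def Abs_ivl_inverse)
  then show ?thesis
    using someI_ex[OF prime_chain_exists[OF assms]] by (simp add: chosen_chain_def)
qed

lemma dim_cong_chosen_chains:
  fixes N N' :: "'a::lattice ivl multiset"
  assumes bcf: "bcf TYPE('a)" and "dim_cong N N'"
  shows "absorption_equiv (\<Sum>i\<in>#N. chosen_chain i) (\<Sum>i\<in>#N'. chosen_chain i)"
  using assms(2)
proof (induction rule: dim_cong.induct)
  case (D0 a)
  then show ?case
    using prime_chain_same[OF chosen_chain[OF bcf order.refl[of a]]]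
    by (simp add: absorption_equiv_refl)
next
  case (D1 a b c)
  then show ?case
    using prime_chain_unique[OF bcf chosen_chain[OF bcf]
        prime_chain_append[OF chosen_chain[OF bcf D1(1)] chosen_chain[OF bcf D1(2)]]]
    by (simp add: order_trans add.commute)
next
  case (D2 a b)
  have "prime_chain (inf b a) b (chosen_chain (ivl (inf a b) b))"
    using chosen_chain[OF bcf, of "inf a b" b] by (simp add: inf_commute)
  moreover have "prime_chain a (sup b a) (chosen_chain (ivl a (sup a b)))"
    using chosen_chain[OF bcf, of a "sup a b"] by (simp add: sup_commute)
  ultimately show ?case
    using prime_chain_D2[OF bcf] absorption_equiv_sym by fastforce
next
  case (refl X)
  then show ?case by (rule absorption_equiv_refl)
next
  case (sym X Y)
  then show ?case by (metis absorption_equiv_sym)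
next
  case (trans X Y Z)
  then show ?case by (metis absorption_equiv_trans)
next
  case (add X Y Z)
  then show ?case by (simp add: absorption_equiv_add)
qed

definition prime_Deltas :: "'a::lattice Dim set" where
  "prime_Deltas = {Delta a b | a b. covered_by a b}"

lemma prime_chain_subset: "prime_chain a b X \<Longrightarrow> set_mset X \<subseteq> prime_Deltas"
  unfolding prime_Deltas_def by (blast dest: prime_chain_step)

lemma Dim_generated_by_prime_Deltas:
  fixes m :: "'a::lattice Dim"
  assumes bcf: "bcf TYPE('a)"
  shows "\<exists>X. set_mset X \<subseteq> prime_Deltas \<and> sum_mset X = m"
proof -
  have "\<exists>X. set_mset X \<subseteq> prime_Deltas \<and> sum_mset X = abs_Dim N" for N :: "'a ivl multiset"
  proof (induction N)
    case empty
    then show ?case by (intro exI[of _ "{#}"]) (simp add: zero_Dim_def)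
  next
    case (add i N)
    then obtain X where X: "set_mset X \<subseteq> prime_Deltas" "sum_mset X = abs_Dim N" by blast
    obtain a b where ab: "i = ivl a b" "a \<le> b"
      unfolding ivl_def by (cases i) auto
    obtain Y where Y: "prime_chain a b Y" using prime_chain_exists[OF bcf ab(2)] by blast
    have "sum_mset (Y + X) = abs_Dim ({#i#} + N)"
      using prime_chain_sum[OF Y] X(2) by (simp add: Delta.abs_eq ab(1) plus_Dim.abs_eq)
    then show ?case
      using prime_chain_subset[OF Y] X(1) by (intro exI[of _ "Y + X"]) simp
  qed
  then show ?thesis by (metis Quotient3_abs_rep Quotient3_Dim)
qed

text \<open>
  A covering step is its own maximal chain, so a multiset over \<open>prime_Deltas\<close> is recovered from a
  suitable representative of its sum by choosing chains. Hence \<open>dim_cong_chosen_chains\<close> turns equality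
  of sums in \<open>Dim L\<close> into \<open>absorption_equiv\<close>.
\<close>

lemma prime_Deltas_lift:
  fixes X :: "'a::lattice Dim multiset"
  assumes bcf: "bcf TYPE('a)" and "set_mset X \<subseteq> prime_Deltas"
  shows "\<exists>N. abs_Dim N = sum_mset X \<and> (\<Sum>i\<in>#N. chosen_chain i) = X"
  using assms(2)
proof (induction X)
  case empty
  then show ?case by (intro exI[of _ "{#}"]) (simp add: zero_Dim_def)
next
  case (add e X)
  then obtain N where N: "abs_Dim N = sum_mset X" "(\<Sum>i\<in>#N. chosen_chain i) = X" by auto
  obtain a b where ab: "e = Delta a b" "covered_by a b"
    using add.prems by (auto simp: prime_Deltas_def)
  have "prime_chain a b (chosen_chain (ivl a b))"
    using ab(2) by (intro chosen_chain[OF bcf]) (simp add: covered_by_def less_imp_le)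
  then have "chosen_chain (ivl a b) = {#e#}"
    using prime_chain_cover[OF ab(2)] ab(1) by simp
  moreover have "abs_Dim ({#ivl a b#} + N) = e + sum_mset X"
    by (simp add: ab(1) Delta.abs_eq plus_Dim.abs_eq flip: N(1))
  ultimately show ?case
    using N(2) by (intro exI[of _ "{#ivl a b#} + N"]) simp
qed

lemma absorption_presented_Dim:
  assumes bcf: "bcf TYPE('a::lattice)"
  shows "absorption_presented (prime_Deltas :: 'a Dim set)"
proof
  fix m :: "'a Dim"
  show "\<exists>X. set_mset X \<subseteq> prime_Deltas \<and> sum_mset X = m"
    by (rule Dim_generated_by_prime_Deltas[OF bcf])
next
  fix X Y :: "'a Dim multiset"
  assume XY: "set_mset X \<subseteq> prime_Deltas" "set_mset Y \<subseteq> prime_Deltas" "sum_mset X = sum_mset Y"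
  obtain N where N: "abs_Dim N = sum_mset X" "(\<Sum>i\<in>#N. chosen_chain i) = X"
    using prime_Deltas_lift[OF bcf XY(1)] by blast
  obtain N' where N': "abs_Dim N' = sum_mset Y" "(\<Sum>i\<in>#N'. chosen_chain i) = Y"
    using prime_Deltas_lift[OF bcf XY(2)] by blast
  have "dim_cong N N'" using N N' XY(3) by (simp flip: Dim.abs_eq_iff)
  then show "absorption_equiv X Y" using dim_cong_chosen_chains[OF bcf] N N' by metis
qed

theorem corollary7p9:
  assumes "bcf TYPE('a::lattice)"
  shows "antisymmetric_monoid TYPE('a Dim) \<and>
         refinement_monoid TYPE('a Dim) \<and>
         interval_axiom TYPE('a Dim) \<and>
         pseudo_cancellation TYPE('a Dim) \<and>
         embeds_in_enat_power TYPE('a Dim)"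
proof -
  interpret absorption_presented "prime_Deltas :: 'a Dim set"
    by (rule absorption_presented_Dim[OF assms])
  show ?thesis
    using antisymmetric refinement interval pseudo_cancel embeds by blast
qed

end
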